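(* (Working in ZF.) Let $X$ be a set such that $X\times X\preceq^* X$. Let $U$ be an ultrafilter over $X$ such that the ultrapower embedding $j_U$ has a critical point $\kappa$, and let $\alpha\ge\kappa$ be an ordinal. If $j_U[\alpha]\in M_U$, then $\alpha\preceq^* X$.
   Context: Write $A\preceq^* B$ if there is a partial surjection from $B$ onto $A$. For an ultrafilter $U$ over $X$, $M_U$ is the ultrapower of $V$ by $U$: its elements are classes $[f]_U$ of functions $f$ with domain $X$ modulo agreement on a $U$-large set, with $[f]_U\in_U[g]_U$ iff $\{x: f(x)\in g(x)\}\in U$, and $j_U(a)=[c_a]_U$ where $c_a$ is the constant function with value $a$ (Łoś's theorem and wellfoundedness are not assumed). The critical point of $j_U$ is the least ordinal $\kappa$ such that some function $f:X\to\kappa$ is not constant on any set in $U$. "$j_U[\alpha]\in M_U$" means there is a function $g$ on $X$ such that for every function $f$ on $X$, $[f]_U\in_U[g]_U$ iff $[f]_U=j_U(\beta)$ for some $\beta<\alpha$. *)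

theory Defs
  imports Main
begin

text \<open>
  ``Working in ZF'' is rendered as truth in every structure \<open>('v, E)\<close> satisfying the first-order
  axioms of ZF.  The Separation and Replacement schemes range over first-order formulas only: if
  they ranged over arbitrary HOL predicates, the choice operator of HOL would force the axiom of
  choice to hold in the structure.
\<close>

datatype fm = Mem nat nat | Eq nat nat | Neg fm | Conj fm fm | All nat fm

primrec sat :: "('v \<Rightarrow> 'v \<Rightarrow> bool) \<Rightarrow> (nat \<Rightarrow> 'v) \<Rightarrow> fm \<Rightarrow> bool" where
  "sat E e (Mem i j) \<longleftrightarrow> E (e i) (e j)"
| "sat E e (Eq i j) \<longleftrightarrow> e i = e j"
| "sat E e (Neg \<phi>) \<longleftrightarrow> \<not> sat E e \<phi>"
| "sat E e (Conj \<phi> \<psi>) \<longleftrightarrow> sat E e \<phi> \<and> sat E e \<psi>"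
| "sat E e (All i \<phi>) \<longleftrightarrow> (\<forall>x. sat E (e(i := x)) \<phi>)"

definition elts :: "('v \<Rightarrow> 'v \<Rightarrow> bool) \<Rightarrow> 'v \<Rightarrow> 'v set" where
  "elts E a = {x. E x a}"

text \<open>In the two schemes the assignment \<open>e\<close> supplies the parameters of the formula.\<close>

locale ZF_model =
  fixes E :: "'v \<Rightarrow> 'v \<Rightarrow> bool"
  assumes extensionality: "elts E a = elts E b \<Longrightarrow> a = b"
    and foundation: "elts E a \<noteq> {} \<Longrightarrow> \<exists>x\<in>elts E a. elts E x \<inter> elts E a = {}"
    and pairing: "\<exists>c. elts E c = {a, b}"
    and union: "\<exists>u. elts E u = (\<Union>x\<in>elts E a. elts E x)"
    and powerset: "\<exists>p. elts E p = {b. elts E b \<subseteq> elts E a}"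
    and infinity: "\<exists>w. (\<exists>z\<in>elts E w. elts E z = {}) \<and>
      (\<forall>x\<in>elts E w. \<exists>y\<in>elts E w. elts E y = insert x (elts E x))"
    and separation: "\<exists>b. elts E b = {x \<in> elts E a. sat E (e(0 := x)) \<phi>}"
    and replacement:
      "(\<And>x y y'. x \<in> elts E a \<Longrightarrow> sat E (e(0 := x, 1 := y)) \<phi> \<Longrightarrow>
          sat E (e(0 := x, 1 := y')) \<phi> \<Longrightarrow> y = y') \<Longrightarrow>
       \<exists>b. elts E b = {y. \<exists>x\<in>elts E a. sat E (e(0 := x, 1 := y)) \<phi>}"

context
  fixes E :: "'v \<Rightarrow> 'v \<Rightarrow> bool"  (infix \<open>\<epsilon>\<close> 50)
begin

text \<open>
  The element of the structure with the given extension; it is applied only to extensions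
  which the axioms of ZF guarantee to be realised by an element.
\<close>

definition set_of :: "'v set \<Rightarrow> 'v" where
  "set_of A = (THE a. elts E a = A)"

definition opair :: "'v \<Rightarrow> 'v \<Rightarrow> 'v" where
  "opair x y = set_of {set_of {x}, set_of {x, y}}"

definition cprod :: "'v \<Rightarrow> 'v \<Rightarrow> 'v" where
  "cprod A B = set_of {opair x y | x y. x \<epsilon> A \<and> y \<epsilon> B}"

definition surj_le :: "'v \<Rightarrow> 'v \<Rightarrow> bool" where
  "surj_le A B \<longleftrightarrow> (\<exists>f.
     (\<forall>p. p \<epsilon> f \<longrightarrow> (\<exists>x y. x \<epsilon> B \<and> y \<epsilon> A \<and> p = opair x y)) \<and>
     (\<forall>x y y'. opair x y \<epsilon> f \<longrightarrow> opair x y' \<epsilon> f \<longrightarrow> y = y') \<and>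
     (\<forall>y. y \<epsilon> A \<longrightarrow> (\<exists>x. opair x y \<epsilon> f)))"

definition fun_on :: "'v \<Rightarrow> 'v \<Rightarrow> bool" where
  "fun_on X f \<longleftrightarrow>
     (\<forall>p. p \<epsilon> f \<longrightarrow> (\<exists>x y. x \<epsilon> X \<and> p = opair x y)) \<and>
     (\<forall>x. x \<epsilon> X \<longrightarrow> (\<exists>!y. opair x y \<epsilon> f))"

definition app :: "'v \<Rightarrow> 'v \<Rightarrow> 'v" where
  "app f x = (THE y. opair x y \<epsilon> f)"

definition const_fun :: "'v \<Rightarrow> 'v \<Rightarrow> 'v" where
  "const_fun X a = set_of {opair x a | x. x \<epsilon> X}"

definition ordinal :: "'v \<Rightarrow> bool" where
  "ordinal \<alpha> \<longleftrightarrow>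
     (\<forall>\<beta>. \<beta> \<epsilon> \<alpha> \<longrightarrow> elts E \<beta> \<subseteq> elts E \<alpha>) \<and>
     (\<forall>\<beta> \<gamma>. \<beta> \<epsilon> \<alpha> \<longrightarrow> \<gamma> \<epsilon> \<alpha> \<longrightarrow> \<beta> \<epsilon> \<gamma> \<or> \<beta> = \<gamma> \<or> \<gamma> \<epsilon> \<beta>) \<and>
     (\<forall>s. elts E s \<subseteq> elts E \<alpha> \<longrightarrow> elts E s \<noteq> {} \<longrightarrow> (\<exists>\<mu>. \<mu> \<epsilon> s \<and> (\<forall>\<beta>. \<beta> \<epsilon> s \<longrightarrow> \<not> \<beta> \<epsilon> \<mu>)))"

definition ord_le :: "'v \<Rightarrow> 'v \<Rightarrow> bool" where
  "ord_le \<alpha> \<beta> \<longleftrightarrow> \<alpha> \<epsilon> \<beta> \<or> \<alpha> = \<beta>"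

definition ultrafilter_over :: "'v \<Rightarrow> 'v \<Rightarrow> bool" where
  "ultrafilter_over X U \<longleftrightarrow>
     (\<forall>A. A \<epsilon> U \<longrightarrow> elts E A \<subseteq> elts E X) \<and>
     X \<epsilon> U \<and>
     (\<forall>A. A \<epsilon> U \<longrightarrow> elts E A \<noteq> {}) \<and>
     (\<forall>A B. A \<epsilon> U \<longrightarrow> elts E A \<subseteq> elts E B \<longrightarrow> elts E B \<subseteq> elts E X \<longrightarrow> B \<epsilon> U) \<and>
     (\<forall>A B. A \<epsilon> U \<longrightarrow> B \<epsilon> U \<longrightarrow> set_of (elts E A \<inter> elts E B) \<epsilon> U) \<and>
     (\<forall>A. elts E A \<subseteq> elts E X \<longrightarrow> A \<epsilon> U \<or> set_of (elts E X - elts E A) \<epsilon> U)"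

text \<open>
  The elements of the ultrapower are proper classes of the structure; they are represented by
  HOL sets of elements of the structure.
\<close>

definition ult_class :: "'v \<Rightarrow> 'v \<Rightarrow> 'v \<Rightarrow> 'v set" where
  "ult_class X U f = {g. fun_on X g \<and> set_of {x \<in> elts E X. app f x = app g x} \<epsilon> U}"

definition ult_mem :: "'v \<Rightarrow> 'v \<Rightarrow> 'v set \<Rightarrow> 'v set \<Rightarrow> bool" where
  "ult_mem X U a b \<longleftrightarrow> (\<exists>f\<in>a. \<exists>g\<in>b. set_of {x \<in> elts E X. app f x \<epsilon> app g x} \<epsilon> U)"

definition ult_embed :: "'v \<Rightarrow> 'v \<Rightarrow> 'v \<Rightarrow> 'v set" where
  "ult_embed X U a = ult_class X U (const_fun X a)"

definition has_nonconstant_fun :: "'v \<Rightarrow> 'v \<Rightarrow> 'v \<Rightarrow> bool" where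
  "has_nonconstant_fun X U \<kappa> \<longleftrightarrow>
     (\<exists>f. fun_on X f \<and> (\<forall>x. x \<epsilon> X \<longrightarrow> app f x \<epsilon> \<kappa>) \<and>
       \<not> (\<exists>A c. A \<epsilon> U \<and> (\<forall>x. x \<epsilon> A \<longrightarrow> app f x = c)))"

definition critical_point :: "'v \<Rightarrow> 'v \<Rightarrow> 'v \<Rightarrow> bool" where
  "critical_point X U \<kappa> \<longleftrightarrow>
     ordinal \<kappa> \<and> has_nonconstant_fun X U \<kappa> \<and>
     (\<forall>\<mu>. ordinal \<mu> \<longrightarrow> has_nonconstant_fun X U \<mu> \<longrightarrow> ord_le \<kappa> \<mu>)"

text \<open>The pointwise image of \<open>\<alpha>\<close> under the ultrapower embedding belongs to the ultrapower.\<close>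

definition image_in_ultrapower :: "'v \<Rightarrow> 'v \<Rightarrow> 'v \<Rightarrow> bool" where
  "image_in_ultrapower X U \<alpha> \<longleftrightarrow>
     (\<exists>g. fun_on X g \<and>
       (\<forall>f. fun_on X f \<longrightarrow>
         (ult_mem X U (ult_class X U f) (ult_class X U g) \<longleftrightarrow>
          (\<exists>\<beta>. \<beta> \<epsilon> \<alpha> \<and> ult_class X U f = ult_embed X U \<beta>))))"

end

end

theory Submission
  imports Defs
begin

text \<open>
  Let \<open>f : X \<rightarrow> \<kappa>\<close> be constant on no set in \<open>U\<close> and let \<open>g\<close> represent \<open>j[\<alpha>]\<close>.  Define a partial
  function \<open>t\<close> from \<open>X\<close> to \<open>\<alpha>\<close> by recursion along \<open>f\<close>: \<open>t(x)\<close> is the least element of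
  \<open>g(x) \<inter> \<alpha>\<close> different from all \<open>t(y)\<close> with \<open>f(y) < f(x)\<close>, if there is one.  If \<open>dom t \<in> U\<close>, then
  \<open>[t] \<in> [g] = j[\<alpha>]\<close>, so \<open>t\<close> is constant on a set in \<open>U\<close>, and \<open>f\<close> is constant there too because \<open>t\<close>
  takes different values at points where \<open>f\<close> does.  So the complement of \<open>dom t\<close> is in \<open>U\<close>.
  Every \<open>\<beta> < \<alpha>\<close> lies in \<open>g(x)\<close> for \<open>U\<close>-many \<open>x\<close>, hence for some \<open>x \<notin> dom t\<close>, and this means that \<open>\<beta>\<close>
  is a value of \<open>t\<close>.  So \<open>t\<close> is onto \<open>\<alpha>\<close>.
\<close>

section \<open>Definability with parameters\<close>

primrec rename_vars :: "(nat \<Rightarrow> nat) \<Rightarrow> fm \<Rightarrow> fm" where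
  "rename_vars \<rho> (Mem i j) = Mem (\<rho> i) (\<rho> j)"
| "rename_vars \<rho> (Eq i j) = Eq (\<rho> i) (\<rho> j)"
| "rename_vars \<rho> (Neg \<phi>) = Neg (rename_vars \<rho> \<phi>)"
| "rename_vars \<rho> (Conj \<phi> \<psi>) = Conj (rename_vars \<rho> \<phi>) (rename_vars \<rho> \<psi>)"
| "rename_vars \<rho> (All i \<phi>) = All (\<rho> i) (rename_vars \<rho> \<phi>)"

lemma sat_rename_vars:
  assumes "inj \<rho>"
  shows "sat E e (rename_vars \<rho> \<phi>) \<longleftrightarrow> sat E (e \<circ> \<rho>) \<phi>"
proof (induction \<phi> arbitrary: e)
  case (All i \<phi>)
  have "e(\<rho> i := x) \<circ> \<rho> = (e \<circ> \<rho>)(i := x)" for x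
    using assms by (auto simp: fun_eq_iff inj_eq)
  then show ?case
    by (simp only: rename_vars.simps sat.simps All)
qed simp_all

definition prepend :: "nat \<Rightarrow> (nat \<Rightarrow> 'v) \<Rightarrow> (nat \<Rightarrow> 'v) \<Rightarrow> nat \<Rightarrow> 'v" where
  "prepend k p e i = (if i < k then p i else e (i - k))"

text \<open>
  The values \<open>p 0, \<dots>, p (k - 1)\<close> are the parameters.  Variables are de Bruijn indices: below a
  quantifier the bound variable is \<open>e 0\<close> and the outer variables are shifted by one.
\<close>

definition definable :: "('v \<Rightarrow> 'v \<Rightarrow> bool) \<Rightarrow> ((nat \<Rightarrow> 'v) \<Rightarrow> bool) \<Rightarrow> bool" where
  "definable E P \<longleftrightarrow> (\<exists>\<phi> k p. \<forall>e. P e \<longleftrightarrow> sat E (prepend k p e) \<phi>)"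

definition atomic_term :: "((nat \<Rightarrow> 'v) \<Rightarrow> 'v) \<Rightarrow> bool" where
  "atomic_term t \<longleftrightarrow> (\<exists>i. t = (\<lambda>e. e i)) \<or> (\<exists>a. t = (\<lambda>_. a))"

lemma atomic_term_var: "atomic_term (\<lambda>e. e i)"
  by (auto simp: atomic_term_def)

lemma atomic_term_param: "atomic_term (\<lambda>_. a)"
  by (auto simp: atomic_term_def)

lemma atomic_term_shift: "atomic_term t \<Longrightarrow> atomic_term (\<lambda>e. t (\<lambda>n. e (Suc n)))"
  by (auto simp: atomic_term_def)

lemma atomic_term_index:
  assumes "atomic_term t" and "m < k"
  shows "\<exists>i a. \<forall>p e. p m = a \<longrightarrow> prepend k p e i = t e"
  using assms(1) unfolding atomic_term_def
proof (elim disjE exE)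
  fix i assume "t = (\<lambda>e. e i)"
  then have "prepend k p e (k + i) = t e" for p e
    by (simp add: prepend_def)
  then show ?thesis
    by blast
next
  fix a assume "t = (\<lambda>_. a)"
  then have "\<forall>p e. p m = a \<longrightarrow> prepend k p e m = t e"
    using \<open>m < k\<close> by (simp add: prepend_def)
  then show ?thesis
    by blast
qed

lemma atomic_term_indices:
  assumes "atomic_term t" and "atomic_term u"
  shows "\<exists>i j k p. \<forall>e. prepend k p e i = t e \<and> prepend k p e j = u e"
proof -
  obtain i a where i: "\<forall>p e. p 0 = a \<longrightarrow> prepend 2 p e i = t e"
    using atomic_term_index[OF assms(1), of 0 2] by auto
  obtain j b where j: "\<forall>p e. p 1 = b \<longrightarrow> prepend 2 p e j = u e"
    using atomic_term_index[OF assms(2), of 1 2] by auto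
  define p where "p n = (if n = 0 then a else b)" for n :: nat
  have "\<forall>e. prepend 2 p e i = t e \<and> prepend 2 p e j = u e"
    using i j by (simp add: p_def)
  then show ?thesis
    by blast
qed

lemma definable_mem:
  assumes "atomic_term t" and "atomic_term u"
  shows "definable E (\<lambda>e. E (t e) (u e))"
proof -
  obtain i j k p where "\<forall>e. prepend k p e i = t e \<and> prepend k p e j = u e"
    using atomic_term_indices[OF assms] by blast
  then have "\<forall>e. E (t e) (u e) \<longleftrightarrow> sat E (prepend k p e) (Mem i j)"
    by simp
  then show ?thesis
    unfolding definable_def by blast
qed

lemma definable_eq:
  assumes "atomic_term t" and "atomic_term u"
  shows "definable E (\<lambda>e. t e = u e)"
proof -
  obtain i j k p where "\<forall>e. prepend k p e i = t e \<and> prepend k p e j = u e"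
    using atomic_term_indices[OF assms] by blast
  then have "\<forall>e. t e = u e \<longleftrightarrow> sat E (prepend k p e) (Eq i j)"
    by simp
  then show ?thesis
    unfolding definable_def by blast
qed

lemma definable_not: "definable E P \<Longrightarrow> definable E (\<lambda>e. \<not> P e)"
  unfolding definable_def using sat.simps(3) by blast

lemma definable_conj:
  assumes "definable E P" and "definable E Q"
  shows "definable E (\<lambda>e. P e \<and> Q e)"
proof -
  obtain \<phi> k p where P: "\<And>e. P e \<longleftrightarrow> sat E (prepend k p e) \<phi>"
    using assms(1) unfolding definable_def by blast
  obtain \<psi> l q where Q: "\<And>e. Q e \<longleftrightarrow> sat E (prepend l q e) \<psi>"
    using assms(2) unfolding definable_def by blast
  define \<rho> where "\<rho> i = (if i < k then i else i + l)" for i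
  define \<sigma> where "\<sigma> i = i + k" for i
  have "inj \<rho>" "inj \<sigma>"
    by (auto simp: inj_def \<rho>_def \<sigma>_def)
  have "prepend (k + l) (prepend k p q) e \<circ> \<rho> = prepend k p e"
    "prepend (k + l) (prepend k p q) e \<circ> \<sigma> = prepend l q e" for e
    by (auto simp: fun_eq_iff prepend_def \<rho>_def \<sigma>_def)
  then have "P e \<and> Q e \<longleftrightarrow> sat E (prepend (k + l) (prepend k p q) e)
      (Conj (rename_vars \<rho> \<phi>) (rename_vars \<sigma> \<psi>))" for e
    by (simp add: P Q sat_rename_vars \<open>inj \<rho>\<close> \<open>inj \<sigma>\<close>)
  then show ?thesis
    unfolding definable_def by blast
qed

lemma definable_all:
  assumes "definable E (\<lambda>e. P (\<lambda>n. e (Suc n)) (e 0))"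
  shows "definable E (\<lambda>e. \<forall>x. P e x)"
proof -
  obtain \<phi> k p where \<phi>: "\<And>e. P (\<lambda>n. e (Suc n)) (e 0) \<longleftrightarrow> sat E (prepend k p e) \<phi>"
    using assms unfolding definable_def by blast
  have "prepend k p (case_nat x e) = (prepend (Suc k) p e)(k := x)" for x e
    by (auto simp: fun_eq_iff prepend_def split: nat.split intro!: arg_cong[of _ _ e])
  then have "P e x \<longleftrightarrow> sat E ((prepend (Suc k) p e)(k := x)) \<phi>" for x e
    using \<phi>[of "case_nat x e"] by simp
  then have "\<forall>e. (\<forall>x. P e x) \<longleftrightarrow> sat E (prepend (Suc k) p e) (All k \<phi>)"
    by simp
  then show ?thesis
    unfolding definable_def by blast
qed

lemma definable_disj:
  assumes "definable E P" and "definable E Q"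
  shows "definable E (\<lambda>e. P e \<or> Q e)"
proof -
  have "definable E (\<lambda>e. \<not> (\<not> P e \<and> \<not> Q e))"
    by (intro definable_not definable_conj assms)
  then show ?thesis
    by simp
qed

lemma definable_imp:
  assumes "definable E P" and "definable E Q"
  shows "definable E (\<lambda>e. P e \<longrightarrow> Q e)"
  unfolding imp_conv_disj by (intro definable_disj definable_not assms)

lemma definable_iff:
  assumes "definable E P" and "definable E Q"
  shows "definable E (\<lambda>e. P e \<longleftrightarrow> Q e)"
  unfolding iff_conv_conj_imp by (intro definable_conj definable_imp assms)

lemma definable_ex:
  assumes "definable E (\<lambda>e. P (\<lambda>n. e (Suc n)) (e 0))"
  shows "definable E (\<lambda>e. \<exists>x. P e x)"
proof -
  have "definable E (\<lambda>e. \<not> (\<forall>x. \<not> P e x))"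
    by (intro definable_not definable_all assms)
  then show ?thesis
    by simp
qed

lemmas definable_connectives =
  atomic_term_var atomic_term_param definable_mem definable_eq
  definable_not definable_conj definable_disj definable_imp definable_iff
  definable_all definable_ex

lemma definable_subst2:
  assumes P: "definable E (\<lambda>e. P (e 1) (e 0))" and t: "atomic_term t" and u: "atomic_term u"
  shows "definable E (\<lambda>e. P (t e) (u e))"
proof -
  have "definable E (\<lambda>e. \<exists>x y. x = t e \<and> y = u e \<and> P x y)"
    using P unfolding One_nat_def
    by (intro definable_ex definable_conj definable_eq atomic_term_var
      atomic_term_shift[OF atomic_term_shift] t u)
  then show ?thesis
    by simp
qed

lemma definable_subst3:
  assumes P: "definable E (\<lambda>e. P (e 2) (e 1) (e 0))"
    and t: "atomic_term t" and u: "atomic_term u" and v: "atomic_term v"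
  shows "definable E (\<lambda>e. P (t e) (u e) (v e))"
proof -
  have "definable E (\<lambda>e. \<exists>x y z. x = t e \<and> y = u e \<and> z = v e \<and> P x y z)"
    using P unfolding One_nat_def numeral_2_eq_2
    by (intro definable_ex definable_conj definable_eq atomic_term_var
      atomic_term_shift[OF atomic_term_shift[OF atomic_term_shift]] t u v)
  then show ?thesis
    by simp
qed

section \<open>Sets and relations in a model of ZF\<close>

context ZF_model
begin

notation E (infix \<open>\<epsilon>\<close> 50)

abbreviation rel :: "'v \<Rightarrow> 'v \<Rightarrow> 'v \<Rightarrow> bool" where
  "rel r x y \<equiv> opair E x y \<epsilon> r"

lemma in_elts [simp]: "x \<in> elts E a \<longleftrightarrow> x \<epsilon> a"
  by (simp add: elts_def)

lemma separation_definable: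
  assumes "definable E (\<lambda>e. P (e 0))"
  shows "\<exists>b. elts E b = {x \<in> elts E a. P x}"
proof -
  obtain \<phi> k p where \<phi>: "\<And>e. P (e 0) \<longleftrightarrow> sat E (prepend k p e) \<phi>"
    using assms unfolding definable_def by blast
  define \<rho> where "\<rho> i = (if i = k then 0 else Suc i)" for i
  define e where "e i = prepend k p (\<lambda>_. a) (i - 1)" for i
  have "inj \<rho>"
    by (auto simp: inj_def \<rho>_def)
  have "prepend k p (case_nat x (\<lambda>_. a)) = e(0 := x) \<circ> \<rho>" for x
    by (auto simp: fun_eq_iff prepend_def \<rho>_def e_def split: nat.split)
  then have "P x \<longleftrightarrow> sat E (e(0 := x)) (rename_vars \<rho> \<phi>)" for x
    using \<phi>[of "case_nat x (\<lambda>_. a)"] by (simp add: sat_rename_vars \<open>inj \<rho>\<close>)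
  then show ?thesis
    using separation by simp
qed

lemma separation_mem_iff:
  assumes "definable E (\<lambda>e. P (e 0))"
  shows "\<exists>b. \<forall>x. x \<epsilon> b \<longleftrightarrow> x \<epsilon> a \<and> P x"
  using separation_definable[OF assms, of a] by (auto simp: set_eq_iff)

lemma set_of_elts [simp]: "set_of E (elts E a) = a"
  unfolding set_of_def by (rule the_equality) (auto intro: extensionality)

lemma elts_set_of: "\<exists>a. elts E a = A \<Longrightarrow> elts E (set_of E A) = A"
  by auto

lemma elts_singleton [simp]: "elts E (set_of E {x}) = {x}"
  using pairing[of x x] elts_set_of by simp

lemma elts_doubleton [simp]: "elts E (set_of E {x, y}) = {x, y}"
  using pairing elts_set_of by blast

lemma set_of_doubleton_eq_iff: "set_of E {x, y} = set_of E {u, v} \<longleftrightarrow> {x, y} = {u, v}"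
  by (metis elts_doubleton)

lemma opair_inject [simp]: "opair E x y = opair E u v \<longleftrightarrow> x = u \<and> y = v"
proof
  assume "opair E x y = opair E u v"
  then have "set_of E {set_of E {x, x}, set_of E {x, y}}
    = set_of E {set_of E {u, u}, set_of E {u, v}}"
    by (simp add: opair_def)
  then show "x = u \<and> y = v"
    unfolding set_of_doubleton_eq_iff doubleton_eq_iff by auto
qed simp

lemma eq_set_of_iff: "\<exists>b. elts E b = A \<Longrightarrow> a = set_of E A \<longleftrightarrow> (\<forall>z. z \<epsilon> a \<longleftrightarrow> z \<in> A)"
  by (metis elts_set_of in_elts set_eqI set_of_elts)

lemma eq_opair_iff:
  "p = opair E x y \<longleftrightarrow> (\<exists>a b. (\<forall>z. z \<epsilon> a \<longleftrightarrow> z = x) \<and> (\<forall>z. z \<epsilon> b \<longleftrightarrow> z = x \<or> z = y)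
     \<and> (\<forall>z. z \<epsilon> p \<longleftrightarrow> z = a \<or> z = b))"
proof -
  have "(\<forall>z. z \<epsilon> a \<longleftrightarrow> z = u \<or> z = v) \<longleftrightarrow> a = set_of E {u, v}" for a u v
    using eq_set_of_iff[OF pairing] by simp
  moreover from this have "(\<forall>z. z \<epsilon> a \<longleftrightarrow> z = x) \<longleftrightarrow> a = set_of E {x}" for a
    using calculation[of a x x] by simp
  ultimately show ?thesis
    by (simp add: opair_def)
qed

lemma definable_eq_opair:
  "\<lbrakk>atomic_term t; atomic_term u; atomic_term v\<rbrakk> \<Longrightarrow> definable E (\<lambda>e. t e = opair E (u e) (v e))"
  by (rule definable_subst3) (unfold eq_opair_iff, intro definable_connectives)

lemma definable_rel:
  "\<lbrakk>atomic_term r; atomic_term t; atomic_term u\<rbrakk> \<Longrightarrow> definable E (\<lambda>e. rel (r e) (t e) (u e))"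
proof (rule definable_subst3[where P = rel])
  have "definable E (\<lambda>e. \<exists>p. p = opair E (e 1) (e 0) \<and> p \<epsilon> e 2)"
    by (intro definable_connectives definable_eq_opair)
  then show "definable E (\<lambda>e. rel (e 2) (e 1) (e 0))"
    by simp
qed

lemmas definable_intros = definable_connectives definable_eq_opair definable_rel

definition relation_between :: "'v \<Rightarrow> 'v \<Rightarrow> 'v \<Rightarrow> bool" where
  "relation_between A B r \<longleftrightarrow> (\<forall>p. p \<epsilon> r \<longrightarrow> (\<exists>x y. x \<epsilon> A \<and> y \<epsilon> B \<and> p = opair E x y))"

lemma relation_betweenD: "\<lbrakk>relation_between A B r; rel r x y\<rbrakk> \<Longrightarrow> x \<epsilon> A \<and> y \<epsilon> B"
  unfolding relation_between_def by fastforce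

lemma ex_set_of_opairs: "\<exists>c. \<forall>x y. x \<epsilon> A \<longrightarrow> y \<epsilon> B \<longrightarrow> opair E x y \<epsilon> c"
proof -
  obtain u where "elts E u = elts E A \<union> elts E B"
    using union[of "set_of E {A, B}"] by auto
  moreover obtain P where "elts E P = {b. elts E b \<subseteq> elts E u}"
    using powerset by blast
  moreover obtain Q where "elts E Q = {b. elts E b \<subseteq> elts E P}"
    using powerset by blast
  ultimately have "opair E x y \<in> elts E Q" if "x \<epsilon> A" "y \<epsilon> B" for x y
    using that by (simp add: opair_def)
  then show ?thesis
    by auto
qed

lemma ex_relation:
  assumes P: "definable E (\<lambda>e. P (e 1) (e 0))"
  shows "\<exists>r. relation_between A B r \<and> (\<forall>x y. rel r x y \<longleftrightarrow> x \<epsilon> A \<and> y \<epsilon> B \<and> P x y)"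
proof -
  obtain c where opair_in_c: "\<And>x y. \<lbrakk>x \<epsilon> A; y \<epsilon> B\<rbrakk> \<Longrightarrow> opair E x y \<epsilon> c"
    using ex_set_of_opairs by blast
  have "definable E (\<lambda>e. \<exists>x y. x \<epsilon> A \<and> y \<epsilon> B \<and> P x y \<and> e 0 = opair E x y)"
    by (intro definable_intros definable_subst2[OF P])
  from separation_mem_iff[OF this] obtain r where
    r: "\<And>p. p \<epsilon> r \<longleftrightarrow> p \<epsilon> c \<and> (\<exists>x y. x \<epsilon> A \<and> y \<epsilon> B \<and> P x y \<and> p = opair E x y)"
    by blast
  show ?thesis
    unfolding relation_between_def r using opair_in_c by (intro exI[of _ r]) (auto simp: r)
qed

lemma surj_leI:
  assumes "relation_between X A r" and "right_unique (rel r)" and "\<And>y. y \<epsilon> A \<Longrightarrow> \<exists>x. rel r x y"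
  shows "surj_le E A X"
  using assms unfolding surj_le_def relation_between_def right_unique_def by metis

section \<open>Functions and ordinals\<close>

lemma rel_iff_app:
  assumes "fun_on E X f"
  shows "rel f x y \<longleftrightarrow> x \<epsilon> X \<and> app E f x = y"
proof -
  have "x \<epsilon> X" if "rel f x y" for y
    using assms that unfolding fun_on_def by fastforce
  moreover have "\<exists>!y. rel f x y" if "x \<epsilon> X"
    using assms that unfolding fun_on_def by blast
  ultimately show ?thesis
    unfolding app_def by (metis theI')
qed

lemma fun_onI:
  assumes "relation_between X Y r" and "\<And>x. x \<epsilon> X \<Longrightarrow> \<exists>!y. rel r x y"
  shows "fun_on E X r"
  using assms unfolding fun_on_def relation_between_def by blast

lemma fun_on_const_fun: "fun_on E X (const_fun E X a)"
  and app_const_fun: "x \<epsilon> X \<Longrightarrow> app E (const_fun E X a) x = a"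
proof -
  have "definable E (\<lambda>e. e 0 = a)"
    by (intro definable_intros)
  from ex_relation[OF this] obtain r where r: "relation_between X (set_of E {a}) r"
    "\<And>x y. rel r x y \<longleftrightarrow> x \<epsilon> X \<and> y \<epsilon> set_of E {a} \<and> y = a"
    by blast
  have mem_singleton: "y \<epsilon> set_of E {a} \<longleftrightarrow> y = a" for y
    by (metis elts_singleton in_elts singleton_iff)
  have "elts E r = {opair E x a | x. x \<epsilon> X}"
  proof (intro set_eqI iffI)
    fix p assume "p \<in> elts E r"
    then obtain x y where "p = opair E x y" "rel r x y"
      using r(1) unfolding relation_between_def by auto
    then show "p \<in> {opair E x a | x. x \<epsilon> X}"
      using r(2) mem_singleton by auto
  next
    fix p assume "p \<in> {opair E x a | x. x \<epsilon> X}"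
    then obtain x where "p = opair E x a" "x \<epsilon> X"
      by blast
    then show "p \<in> elts E r"
      using r(2)[of x a] mem_singleton by simp
  qed
  then have const_fun: "const_fun E X a = r"
    unfolding const_fun_def by (metis set_of_elts)
  have r_fun: "fun_on E X r"
    using r(1) by (rule fun_onI) (simp add: r(2) mem_singleton)
  show "fun_on E X (const_fun E X a)"
    unfolding const_fun by (rule r_fun)
  show "app E (const_fun E X a) x = a" if "x \<epsilon> X"
    unfolding const_fun using that rel_iff_app[OF r_fun, of x a] by (simp add: r(2) mem_singleton)
qed

lemma ex_fun_on_extending:
  assumes r: "relation_between X Y r" and unique: "right_unique (rel r)" and "a \<epsilon> Y"
  shows "\<exists>h. fun_on E X h \<and> (\<forall>x y. rel r x y \<longrightarrow> app E h x = y)"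
proof -
  have "definable E (\<lambda>e. rel r (e 1) (e 0) \<or> e 0 = a \<and> \<not> (\<exists>z. rel r (e 1) z))"
    by (intro definable_intros)
  from ex_relation[OF this] obtain h where h: "relation_between X Y h"
    "\<And>x y. rel h x y \<longleftrightarrow> x \<epsilon> X \<and> y \<epsilon> Y \<and> (rel r x y \<or> y = a \<and> \<not> (\<exists>z. rel r x z))"
    by blast
  have extends: "rel h x y" if "rel r x y" for x y
    using that relation_betweenD[OF r that] h(2) by simp
  have "\<exists>!y. rel h x y" if "x \<epsilon> X" for x
  proof (cases "\<exists>y. rel r x y")
    case True
    then obtain y where "rel r x y"
      by blast
    then show ?thesis
      using extends h(2) right_uniqueD[OF unique] by (intro ex1I[of _ y]) auto
  next
    case False
    then show ?thesis
      using h(2) \<open>x \<epsilon> X\<close> \<open>a \<epsilon> Y\<close> by (intro ex1I[of _ a]) auto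
  qed
  with h(1) have h_fun: "fun_on E X h"
    by (rule fun_onI)
  moreover have "\<forall>x y. rel r x y \<longrightarrow> app E h x = y"
    using extends rel_iff_app[OF h_fun] by simp
  ultimately show ?thesis
    by blast
qed

lemma ordinal_linear: "\<lbrakk>ordinal E \<kappa>; a \<epsilon> \<kappa>; b \<epsilon> \<kappa>\<rbrakk> \<Longrightarrow> a \<epsilon> b \<or> a = b \<or> b \<epsilon> a"
  unfolding ordinal_def by auto

lemma ordinal_trans: "\<lbrakk>ordinal E \<kappa>; b \<epsilon> \<kappa>; a \<epsilon> b\<rbrakk> \<Longrightarrow> a \<epsilon> \<kappa>"
  unfolding ordinal_def by (meson in_elts subsetD)

lemma ordinal_least:
  assumes \<kappa>: "ordinal E \<kappa>" and P: "definable E (\<lambda>e. P (e 0))" and "a \<epsilon> \<kappa>" and "P a"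
  obtains m where "m \<epsilon> \<kappa>" and "P m" and "\<And>b. b \<epsilon> m \<Longrightarrow> \<not> P b"
proof -
  obtain s where s_iff: "\<And>x. x \<epsilon> s \<longleftrightarrow> x \<epsilon> \<kappa> \<and> P x"
    using separation_mem_iff[OF P] by blast
  then have "elts E s \<subseteq> elts E \<kappa>" "elts E s \<noteq> {}"
    using \<open>a \<epsilon> \<kappa>\<close> \<open>P a\<close> by auto
  then obtain m where "m \<epsilon> s" "\<And>b. b \<epsilon> s \<Longrightarrow> \<not> b \<epsilon> m"
    using \<kappa> unfolding ordinal_def by metis
  then show thesis
    by (intro that[of m]) (use s_iff ordinal_trans[OF \<kappa>] in auto)
qed

end

section \<open>Recursion along a well-founded relation\<close>

locale local_recursion = ZF_model E
  for E :: "'v \<Rightarrow> 'v \<Rightarrow> bool" (infix \<open>\<epsilon>\<close> 50) +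
  fixes A B :: 'v and below :: "'v \<Rightarrow> 'v \<Rightarrow> bool" (infix \<open>\<prec>\<close> 50)
    and \<Phi> :: "'v \<Rightarrow> 'v \<Rightarrow> 'v \<Rightarrow> bool"
  assumes ex_minimal: "\<lbrakk>elts E s \<subseteq> elts E A; elts E s \<noteq> {}\<rbrakk> \<Longrightarrow> \<exists>m. m \<epsilon> s \<and> (\<forall>y. y \<epsilon> s \<longrightarrow> \<not> y \<prec> m)"
    and definable_below: "definable E (\<lambda>e. e 1 \<prec> e 0)"
    and definable_step: "definable E (\<lambda>e. \<Phi> (e 2) (e 1) (e 0))"
    and step_local: "(\<And>y c. \<lbrakk>y \<epsilon> A; y \<prec> x\<rbrakk> \<Longrightarrow> rel t y c \<longleftrightarrow> rel s y c) \<Longrightarrow> \<Phi> t x b \<longleftrightarrow> \<Phi> s x b"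
begin

definition attempt :: "'v \<Rightarrow> 'v \<Rightarrow> bool" where
  "attempt t D \<longleftrightarrow>
     (\<forall>x. x \<epsilon> D \<longrightarrow> x \<epsilon> A \<and> (\<forall>y. y \<epsilon> A \<longrightarrow> y \<prec> x \<longrightarrow> y \<epsilon> D)) \<and>
     (\<forall>x b. rel t x b \<longleftrightarrow> x \<epsilon> D \<and> b \<epsilon> B \<and> \<Phi> t x b)"

lemma definable_attempt:
  "\<lbrakk>atomic_term t; atomic_term d\<rbrakk> \<Longrightarrow> definable E (\<lambda>e. attempt (t e) (d e))"
  by (rule definable_subst2) (unfold attempt_def, intro definable_intros
    definable_subst2[OF definable_below] definable_subst3[OF definable_step])

lemma below_induct:
  assumes P: "definable E (\<lambda>e. P (e 0))" and "x \<epsilon> A"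
    and step: "\<And>x. \<lbrakk>x \<epsilon> A; \<And>y. \<lbrakk>y \<epsilon> A; y \<prec> x\<rbrakk> \<Longrightarrow> P y\<rbrakk> \<Longrightarrow> P x"
  shows "P x"
proof (rule ccontr)
  assume "\<not> P x"
  obtain s where s_iff: "\<And>x. x \<epsilon> s \<longleftrightarrow> x \<epsilon> A \<and> \<not> P x"
    using separation_mem_iff[OF definable_not[OF P]] by blast
  then have "elts E s \<subseteq> elts E A" "elts E s \<noteq> {}"
    using \<open>x \<epsilon> A\<close> \<open>\<not> P x\<close> by auto
  then obtain m where "m \<epsilon> s" "\<And>y. y \<epsilon> s \<Longrightarrow> \<not> y \<prec> m"
    using ex_minimal by blast
  then show False
    using step[of m] unfolding s_iff by blast
qed

lemma attempt_subset: "\<lbrakk>attempt t D; x \<epsilon> D\<rbrakk> \<Longrightarrow> x \<epsilon> A"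
  and attempt_downward: "\<lbrakk>attempt t D; x \<epsilon> D; y \<epsilon> A; y \<prec> x\<rbrakk> \<Longrightarrow> y \<epsilon> D"
  and attempt_rel_iff: "attempt t D \<Longrightarrow> rel t x b \<longleftrightarrow> x \<epsilon> D \<and> b \<epsilon> B \<and> \<Phi> t x b"
  unfolding attempt_def by blast+

lemma attempt_agree:
  assumes t: "attempt t D" and s: "attempt s D'" and "x \<epsilon> D" "x \<epsilon> D'"
  shows "rel t x b \<longleftrightarrow> rel s x b"
proof -
  have "x \<epsilon> D \<and> x \<epsilon> D' \<longrightarrow> (\<forall>b. rel t x b \<longleftrightarrow> rel s x b)"
  proof (rule below_induct[of "\<lambda>x. x \<epsilon> D \<and> x \<epsilon> D' \<longrightarrow> (\<forall>b. rel t x b \<longleftrightarrow> rel s x b)"])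
    show "definable E (\<lambda>e. e 0 \<epsilon> D \<and> e 0 \<epsilon> D' \<longrightarrow> (\<forall>b. rel t (e 0) b \<longleftrightarrow> rel s (e 0) b))"
      by (intro definable_intros)
    show "x \<epsilon> A"
      using attempt_subset[OF t \<open>x \<epsilon> D\<close>] .
  next
    fix x
    assume IH: "\<And>y. \<lbrakk>y \<epsilon> A; y \<prec> x\<rbrakk> \<Longrightarrow>
      y \<epsilon> D \<and> y \<epsilon> D' \<longrightarrow> (\<forall>b. rel t y b \<longleftrightarrow> rel s y b)"
    show "x \<epsilon> D \<and> x \<epsilon> D' \<longrightarrow> (\<forall>b. rel t x b \<longleftrightarrow> rel s x b)"
    proof (intro impI allI)
      fix b
      assume x: "x \<epsilon> D \<and> x \<epsilon> D'"
      then have "\<Phi> t x b \<longleftrightarrow> \<Phi> s x b"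
        using IH attempt_downward[OF t] attempt_downward[OF s] by (intro step_local) blast
      then show "rel t x b \<longleftrightarrow> rel s x b"
        using x attempt_rel_iff[OF t] attempt_rel_iff[OF s] by blast
    qed
  qed
  with \<open>x \<epsilon> D\<close> \<open>x \<epsilon> D'\<close> show ?thesis
    by blast
qed

definition extends_attempts :: "'v \<Rightarrow> bool" where
  "extends_attempts u \<longleftrightarrow>
     (\<forall>t D x b. attempt t D \<longrightarrow> x \<epsilon> D \<longrightarrow> (rel u x b \<longleftrightarrow> rel t x b))"

lemma ex_extends_attempts: "\<exists>u. relation_between A B u \<and> extends_attempts u"
proof -
  have "definable E (\<lambda>e. \<exists>t D. attempt t D \<and> e 1 \<epsilon> D \<and> rel t (e 1) (e 0))"
    by (intro definable_intros definable_attempt)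
  from ex_relation[OF this] obtain u where u: "relation_between A B u"
    "\<And>x b. rel u x b \<longleftrightarrow> x \<epsilon> A \<and> b \<epsilon> B \<and> (\<exists>t D. attempt t D \<and> x \<epsilon> D \<and> rel t x b)"
    by blast
  have "rel u x b \<longleftrightarrow> rel t x b" if t: "attempt t D" and "x \<epsilon> D" for t D x b
  proof
    assume "rel u x b"
    then obtain s D' where "attempt s D'" "x \<epsilon> D'" "rel s x b"
      using u(2) by blast
    then show "rel t x b"
      using attempt_agree[OF t _ \<open>x \<epsilon> D\<close>] by blast
  next
    assume "rel t x b"
    then show "rel u x b"
      using u(2) t \<open>x \<epsilon> D\<close> attempt_subset[OF t \<open>x \<epsilon> D\<close>] attempt_rel_iff[OF t] by blast
  qed
  with u(1) show ?thesis
    unfolding extends_attempts_def by blast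
qed

lemma extends_attempts_rel_iff:
  assumes u: "extends_attempts u" and t: "attempt t D" "x \<epsilon> D"
  shows "rel u x b \<longleftrightarrow> b \<epsilon> B \<and> \<Phi> u x b"
proof -
  have "\<Phi> u x b \<longleftrightarrow> \<Phi> t x b"
    by (rule step_local)
      (use u t attempt_downward[OF t] in \<open>simp add: extends_attempts_def\<close>)
  moreover have "rel u x b \<longleftrightarrow> rel t x b"
    using u t unfolding extends_attempts_def by blast
  ultimately show ?thesis
    using attempt_rel_iff[OF t(1)] t(2) by simp
qed

lemma attempt_extend:
  assumes "x \<epsilon> A" and below_x: "\<And>y. \<lbrakk>y \<epsilon> A; y \<prec> x\<rbrakk> \<Longrightarrow> \<exists>t D. attempt t D \<and> y \<epsilon> D"
  shows "\<exists>t D. attempt t D \<and> x \<epsilon> D"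
proof -
  obtain u where u: "extends_attempts u"
    using ex_extends_attempts by blast
  have "definable E (\<lambda>e. (\<exists>t D. attempt t D \<and> e 0 \<epsilon> D) \<or> e 0 = x)"
    by (intro definable_intros definable_attempt)
  from separation_mem_iff[OF this] obtain C where
    C: "\<And>y. y \<epsilon> C \<longleftrightarrow> y \<epsilon> A \<and> ((\<exists>t D. attempt t D \<and> y \<epsilon> D) \<or> y = x)"
    by blast
  have "definable E (\<lambda>e. \<Phi> u (e 1) (e 0))"
    by (intro definable_intros definable_subst3[OF definable_step])
  from ex_relation[OF this] obtain t where
    t: "\<And>y b. rel t y b \<longleftrightarrow> y \<epsilon> C \<and> b \<epsilon> B \<and> \<Phi> u y b"
    by blast
  have attempted: "\<exists>s D. attempt s D \<and> z \<epsilon> D" if "y \<epsilon> C" "z \<epsilon> A" "z \<prec> y" for y z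
    using that below_x attempt_downward[of _ _ y z] unfolding C by blast
  then have C_downward: "z \<epsilon> C" if "y \<epsilon> C" "z \<epsilon> A" "z \<prec> y" for y z
    using that unfolding C by blast
  have "rel t z c \<longleftrightarrow> rel u z c" if z: "y \<epsilon> C" "z \<epsilon> A" "z \<prec> y" for y z c
    using attempted[OF z] C_downward[OF z] extends_attempts_rel_iff[OF u] unfolding t by blast
  then have "\<Phi> t y b \<longleftrightarrow> \<Phi> u y b" if "y \<epsilon> C" for y b
    using that by (intro step_local) blast
  then have "attempt t C"
    unfolding attempt_def t using C C_downward by blast
  then show ?thesis
    using \<open>x \<epsilon> A\<close> C by blast
qed

theorem ex_recursive_relation:
  "\<exists>u. relation_between A B u \<and> (\<forall>x b. rel u x b \<longleftrightarrow> x \<epsilon> A \<and> b \<epsilon> B \<and> \<Phi> u x b)"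
proof -
  obtain u where u: "relation_between A B u" "extends_attempts u"
    using ex_extends_attempts by blast
  have "definable E (\<lambda>e. \<exists>t D. attempt t D \<and> e 0 \<epsilon> D)"
    by (intro definable_intros definable_attempt)
  then have attempted: "\<exists>t D. attempt t D \<and> x \<epsilon> D" if "x \<epsilon> A" for x
    using that attempt_extend by (rule below_induct)
  have "rel u x b \<longleftrightarrow> x \<epsilon> A \<and> b \<epsilon> B \<and> \<Phi> u x b" for x b
    using attempted[of x] extends_attempts_rel_iff[OF u(2)] relation_betweenD[OF u(1), of x b]
    by blast
  with u(1) show ?thesis
    by blast
qed

end

section \<open>Ultrafilters and ultrapowers\<close>

locale ZF_ultrafilter = ZF_model E
  for E :: "'v \<Rightarrow> 'v \<Rightarrow> bool" (infix \<open>\<epsilon>\<close> 50) +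
  fixes X U :: 'v
  assumes ultrafilter: "ultrafilter_over E X U"
begin

definition large :: "'v filter" where
  "large = (INF A\<in>elts E U. principal (elts E A))"

lemma ultrafilter_subset: "A \<epsilon> U \<Longrightarrow> elts E A \<subseteq> elts E X"
  and ultrafilter_space: "X \<epsilon> U"
  and ultrafilter_nonempty: "A \<epsilon> U \<Longrightarrow> elts E A \<noteq> {}"
  and ultrafilter_mono: "\<lbrakk>A \<epsilon> U; elts E A \<subseteq> elts E B; elts E B \<subseteq> elts E X\<rbrakk> \<Longrightarrow> B \<epsilon> U"
  and ultrafilter_Int: "\<lbrakk>A \<epsilon> U; B \<epsilon> U\<rbrakk> \<Longrightarrow> set_of E (elts E A \<inter> elts E B) \<epsilon> U"
  and ultrafilter_compl: "elts E A \<subseteq> elts E X \<Longrightarrow> A \<epsilon> U \<or> set_of E (elts E X - elts E A) \<epsilon> U"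
  using ultrafilter unfolding ultrafilter_over_def by blast+

lemma eventually_large: "eventually P large \<longleftrightarrow> (\<exists>A. A \<epsilon> U \<and> (\<forall>x. x \<epsilon> A \<longrightarrow> P x))"
proof -
  have "\<exists>C\<in>elts E U. principal (elts E C) \<le> inf (principal (elts E A)) (principal (elts E B))"
    if "A \<in> elts E U" "B \<in> elts E U" for A B
  proof (rule bexI[of _ "set_of E (elts E A \<inter> elts E B)"])
    have "definable E (\<lambda>e. e 0 \<epsilon> B)"
      by (intro definable_intros)
    then have "\<exists>C. elts E C = elts E A \<inter> elts E B"
      using separation_definable[of "\<lambda>x. x \<epsilon> B" A] by (simp add: Int_def)
    then show "principal (elts E (set_of E (elts E A \<inter> elts E B)))
        \<le> inf (principal (elts E A)) (principal (elts E B))"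
      by (simp add: elts_set_of)
    show "set_of E (elts E A \<inter> elts E B) \<in> elts E U"
      using that ultrafilter_Int by simp
  qed
  moreover have "elts E U \<noteq> {}"
    using ultrafilter_space by auto
  ultimately have "eventually P large \<longleftrightarrow> (\<exists>A\<in>elts E U. eventually P (principal (elts E A)))"
    unfolding large_def by (intro eventually_INF_base)
  then show ?thesis
    by (simp add: eventually_principal Bex_def Ball_def)
qed

lemma large_neq_bot: "large \<noteq> bot"
  using ultrafilter_nonempty unfolding trivial_limit_def eventually_large elts_def by blast

lemma eventually_in_space: "\<forall>\<^sub>F x in large. x \<epsilon> X"
  using ultrafilter_space eventually_large by blast

lemma eventually_large_iff_set_of:
  assumes "\<exists>A. elts E A = {x \<in> elts E X. P x}"
  shows "set_of E {x \<in> elts E X. P x} \<epsilon> U \<longleftrightarrow> (\<forall>\<^sub>F x in large. P x)"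
proof -
  have elts: "elts E (set_of E {x \<in> elts E X. P x}) = {x \<in> elts E X. P x}"
    using elts_set_of[OF assms] .
  then have "x \<epsilon> set_of E {x \<in> elts E X. P x} \<longleftrightarrow> x \<epsilon> X \<and> P x" for x
    by (simp add: set_eq_iff)
  moreover have "set_of E {x \<in> elts E X. P x} \<epsilon> U" if "A \<epsilon> U" "\<forall>x. x \<epsilon> A \<longrightarrow> P x" for A
    using that ultrafilter_subset[OF \<open>A \<epsilon> U\<close>]
    by (intro ultrafilter_mono[OF \<open>A \<epsilon> U\<close>]) (unfold elts, auto)
  ultimately show ?thesis
    unfolding eventually_large by blast
qed

lemma eventually_large_cases:
  assumes P: "definable E (\<lambda>e. P (e 0))"
  shows "(\<forall>\<^sub>F x in large. P x) \<or> (\<forall>\<^sub>F x in large. \<not> P x)"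
proof -
  let ?A = "set_of E {x \<in> elts E X. P x}"
  have A: "elts E ?A = {x \<in> elts E X. P x}"
    by (rule elts_set_of[OF separation_definable[OF P]])
  then have "elts E X - elts E ?A = {x \<in> elts E X. \<not> P x}"
    by blast
  moreover have "elts E ?A \<subseteq> elts E X"
    unfolding A by blast
  ultimately have "?A \<epsilon> U \<or> set_of E {x \<in> elts E X. \<not> P x} \<epsilon> U"
    using ultrafilter_compl[of ?A] by argo
  then show ?thesis
    using eventually_large_iff_set_of[OF separation_definable[OF P]]
      eventually_large_iff_set_of[OF separation_definable[OF definable_not[OF P]]] by argo
qed

lemma eventually_app_iff:
  assumes R: "definable E (\<lambda>e. R (e 1) (e 0))" and f: "fun_on E X f" and g: "fun_on E X g"
  shows "set_of E {x \<in> elts E X. R (app E f x) (app E g x)} \<epsilon> U \<longleftrightarrow>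
    (\<forall>\<^sub>F x in large. R (app E f x) (app E g x))"
proof (rule eventually_large_iff_set_of)
  have "definable E (\<lambda>e. \<exists>y z. rel f (e 0) y \<and> rel g (e 0) z \<and> R y z)"
    by (intro definable_intros definable_subst2[OF R])
  then have "\<exists>A. elts E A = {x \<in> elts E X. \<exists>y z. rel f x y \<and> rel g x z \<and> R y z}"
    by (rule separation_definable)
  moreover have "{x \<in> elts E X. \<exists>y z. rel f x y \<and> rel g x z \<and> R y z}
      = {x \<in> elts E X. R (app E f x) (app E g x)}"
    using rel_iff_app[OF f] rel_iff_app[OF g] by auto
  ultimately show "\<exists>A. elts E A = {x \<in> elts E X. R (app E f x) (app E g x)}"
    by simp
qed

lemmas eventually_app_eq_iff =
  eventually_app_iff[where R = "(=)", OF definable_eq[OF atomic_term_var atomic_term_var]]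

lemmas eventually_app_mem_iff =
  eventually_app_iff[where R = E, OF definable_mem[OF atomic_term_var atomic_term_var]]

lemma ult_class_iff:
  assumes "fun_on E X f"
  shows "g \<in> ult_class E X U f \<longleftrightarrow> fun_on E X g \<and> (\<forall>\<^sub>F x in large. app E f x = app E g x)"
  using eventually_app_eq_iff[OF assms] unfolding ult_class_def by blast

lemma ult_class_eq_iff:
  assumes f: "fun_on E X f" and g: "fun_on E X g"
  shows "ult_class E X U f = ult_class E X U g \<longleftrightarrow> (\<forall>\<^sub>F x in large. app E f x = app E g x)"
proof
  assume "ult_class E X U f = ult_class E X U g"
  moreover have "g \<in> ult_class E X U g"
    using g by (simp add: ult_class_iff)
  ultimately show "\<forall>\<^sub>F x in large. app E f x = app E g x"
    using ult_class_iff[OF f] by blast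
next
  assume "\<forall>\<^sub>F x in large. app E f x = app E g x"
  then have "(\<forall>\<^sub>F x in large. app E f x = app E h x) \<longleftrightarrow>
      (\<forall>\<^sub>F x in large. app E g x = app E h x)" for h
    by (intro eventually_cong) (auto elim: eventually_mono)
  then show "ult_class E X U f = ult_class E X U g"
    using ult_class_iff[OF f] ult_class_iff[OF g] by blast
qed

lemma ult_mem_iff:
  assumes f: "fun_on E X f" and g: "fun_on E X g"
  shows "ult_mem E X U (ult_class E X U f) (ult_class E X U g) \<longleftrightarrow>
    (\<forall>\<^sub>F x in large. app E f x \<epsilon> app E g x)"
proof
  assume "ult_mem E X U (ult_class E X U f) (ult_class E X U g)"
  then obtain f' g' where f': "f' \<in> ult_class E X U f" and g': "g' \<in> ult_class E X U g"
    and mem: "set_of E {x \<in> elts E X. app E f' x \<epsilon> app E g' x} \<epsilon> U"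
    unfolding ult_mem_def by blast
  have "\<forall>\<^sub>F x in large. app E f' x \<epsilon> app E g' x"
    using f' g' mem eventually_app_mem_iff unfolding ult_class_def by blast
  moreover have "\<forall>\<^sub>F x in large. app E f x = app E f' x" "\<forall>\<^sub>F x in large. app E g x = app E g' x"
    using f' g' ult_class_iff[OF f] ult_class_iff[OF g] by blast+
  ultimately show "\<forall>\<^sub>F x in large. app E f x \<epsilon> app E g x"
    by eventually_elim simp
next
  assume "\<forall>\<^sub>F x in large. app E f x \<epsilon> app E g x"
  moreover have "f \<in> ult_class E X U f" "g \<in> ult_class E X U g"
    using f g by (simp_all add: ult_class_iff)
  ultimately show "ult_mem E X U (ult_class E X U f) (ult_class E X U g)"
    unfolding ult_mem_def using eventually_app_mem_iff[OF f g] by blast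
qed

lemma eventually_app_const_fun: "\<forall>\<^sub>F x in large. app E (const_fun E X a) x = a"
  using eventually_in_space by (rule eventually_mono) (rule app_const_fun)

lemma ult_class_eq_embed_iff:
  assumes "fun_on E X f"
  shows "ult_class E X U f = ult_embed E X U a \<longleftrightarrow> (\<forall>\<^sub>F x in large. app E f x = a)"
  unfolding ult_embed_def ult_class_eq_iff[OF assms fun_on_const_fun]
  by (rule eventually_cong[OF eventually_app_const_fun[of a]]) simp

lemma image_in_ultrapower_iff:
  "image_in_ultrapower E X U \<alpha> \<longleftrightarrow> (\<exists>g. fun_on E X g \<and> (\<forall>h. fun_on E X h \<longrightarrow>
    ((\<forall>\<^sub>F x in large. app E h x \<epsilon> app E g x) \<longleftrightarrow> (\<exists>\<beta>. \<beta> \<epsilon> \<alpha> \<and> (\<forall>\<^sub>F x in large. app E h x = \<beta>)))))"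
  unfolding image_in_ultrapower_def
  by (simp add: ult_mem_iff ult_class_eq_embed_iff cong: conj_cong)

lemma image_in_ultrapowerE:
  assumes "image_in_ultrapower E X U \<alpha>"
  obtains g where "fun_on E X g"
    and "\<And>\<beta>. \<beta> \<epsilon> \<alpha> \<Longrightarrow> \<forall>\<^sub>F x in large. \<beta> \<epsilon> app E g x"
    and "\<And>h. \<lbrakk>fun_on E X h; \<forall>\<^sub>F x in large. app E h x \<epsilon> app E g x\<rbrakk> \<Longrightarrow>
      \<exists>\<beta>. \<forall>\<^sub>F x in large. app E h x = \<beta>"
proof -
  obtain g where g: "fun_on E X g" and mem_iff: "\<And>h. fun_on E X h \<Longrightarrow>
      (\<forall>\<^sub>F x in large. app E h x \<epsilon> app E g x) \<longleftrightarrow> (\<exists>\<beta>. \<beta> \<epsilon> \<alpha> \<and> (\<forall>\<^sub>F x in large. app E h x = \<beta>))"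
    using assms unfolding image_in_ultrapower_iff by blast
  have mem_g: "\<forall>\<^sub>F x in large. \<beta> \<epsilon> app E g x" if "\<beta> \<epsilon> \<alpha>" for \<beta>
  proof -
    have "\<forall>\<^sub>F x in large. app E (const_fun E X \<beta>) x \<epsilon> app E g x"
      using mem_iff[OF fun_on_const_fun] that eventually_app_const_fun by blast
    with eventually_app_const_fun[of \<beta>] show ?thesis
      by eventually_elim simp
  qed
  show thesis
    by (rule that[OF g mem_g]) (use mem_iff in blast)+
qed

lemma has_nonconstant_funE:
  assumes "has_nonconstant_fun E X U \<kappa>"
  obtains f where "fun_on E X f" and "\<And>x. x \<epsilon> X \<Longrightarrow> app E f x \<epsilon> \<kappa>"
    and "\<And>c. \<not> (\<forall>\<^sub>F x in large. app E f x = c)"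
  using assms unfolding has_nonconstant_fun_def eventually_large by blast

end

section \<open>The greedy choice\<close>

locale greedy_choice = ZF_model E
  for E :: "'v \<Rightarrow> 'v \<Rightarrow> bool" (infix \<open>\<epsilon>\<close> 50) +
  fixes X \<kappa> \<alpha> f g :: 'v
  assumes ordinal_\<kappa>: "ordinal E \<kappa>" and ordinal_\<alpha>: "ordinal E \<alpha>"
    and fun_f: "fun_on E X f" and range_f: "x \<epsilon> X \<Longrightarrow> app E f x \<epsilon> \<kappa>"
    and fun_g: "fun_on E X g"
begin

definition lower :: "'v \<Rightarrow> 'v \<Rightarrow> bool" where
  "lower y x \<longleftrightarrow> (\<exists>u v. rel f y u \<and> rel f x v \<and> u \<epsilon> v)"

definition available :: "'v \<Rightarrow> 'v \<Rightarrow> 'v \<Rightarrow> bool" where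
  "available t x \<beta> \<longleftrightarrow> (\<exists>u. rel g x u \<and> \<beta> \<epsilon> u) \<and> \<not> (\<exists>y. lower y x \<and> rel t y \<beta>)"

definition least_available :: "'v \<Rightarrow> 'v \<Rightarrow> 'v \<Rightarrow> bool" where
  "least_available t x \<beta> \<longleftrightarrow> available t x \<beta> \<and> (\<forall>\<gamma>. \<gamma> \<epsilon> \<beta> \<longrightarrow> \<not> available t x \<gamma>)"

definition greedy :: "'v \<Rightarrow> bool" where
  "greedy t \<longleftrightarrow> relation_between X \<alpha> t \<and>
     (\<forall>x \<beta>. rel t x \<beta> \<longleftrightarrow> x \<epsilon> X \<and> \<beta> \<epsilon> \<alpha> \<and> least_available t x \<beta>)"

lemma lower_iff: "lower y x \<longleftrightarrow> y \<epsilon> X \<and> x \<epsilon> X \<and> app E f y \<epsilon> app E f x"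
  unfolding lower_def rel_iff_app[OF fun_f] by blast

lemma definable_lower: "definable E (\<lambda>e. lower (e 1) (e 0))"
  unfolding lower_def by (intro definable_intros)

lemma definable_available:
  "\<lbrakk>atomic_term t; atomic_term u; atomic_term v\<rbrakk> \<Longrightarrow> definable E (\<lambda>e. available (t e) (u e) (v e))"
  by (rule definable_subst3) (unfold available_def,
    intro definable_intros definable_subst2[OF definable_lower])

lemma ex_minimal_lower:
  assumes "elts E s \<subseteq> elts E X" and "elts E s \<noteq> {}"
  shows "\<exists>m. m \<epsilon> s \<and> (\<forall>y. y \<epsilon> s \<longrightarrow> \<not> lower y m)"
proof -
  have s_sub: "x \<epsilon> X" if "x \<epsilon> s" for x
    using assms(1) that by auto
  obtain x where "x \<epsilon> s"
    using assms(2) by auto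
  have "definable E (\<lambda>e. \<exists>x. x \<epsilon> s \<and> rel f x (e 0))"
    by (intro definable_intros)
  then obtain u where "u \<epsilon> \<kappa>" "\<exists>x. x \<epsilon> s \<and> rel f x u" "\<And>v. v \<epsilon> u \<Longrightarrow> \<not> (\<exists>x. x \<epsilon> s \<and> rel f x v)"
    by (rule ordinal_least[OF ordinal_\<kappa>, of "\<lambda>u. \<exists>x. x \<epsilon> s \<and> rel f x u" "app E f x"])
      (use \<open>x \<epsilon> s\<close> s_sub range_f rel_iff_app[OF fun_f] in auto)
  then show ?thesis
    unfolding lower_iff rel_iff_app[OF fun_f] by blast
qed

lemma least_available_cong:
  assumes "\<And>y \<beta>. lower y x \<Longrightarrow> rel t y \<beta> \<longleftrightarrow> rel s y \<beta>"
  shows "least_available t x \<beta> \<longleftrightarrow> least_available s x \<beta>"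
  unfolding least_available_def available_def using assms by blast

lemma ex_greedy: "\<exists>t. greedy t"
proof -
  have "definable E (\<lambda>e. least_available (e 2) (e 1) (e 0))"
    unfolding least_available_def by (intro definable_intros definable_available)
  then interpret local_recursion E X \<alpha> lower least_available
    by unfold_locales
      (use ex_minimal_lower definable_lower least_available_cong lower_iff in blast)+
  show ?thesis
    unfolding greedy_def by (rule ex_recursive_relation)
qed

lemma right_unique_greedy:
  assumes "greedy t"
  shows "right_unique (rel t)"
proof (rule right_uniqueI)
  fix x \<beta> \<gamma>
  assume "rel t x \<beta>" "rel t x \<gamma>"
  then have "\<beta> \<epsilon> \<alpha>" "\<gamma> \<epsilon> \<alpha>" "least_available t x \<beta>" "least_available t x \<gamma>"
    using assms unfolding greedy_def by blast+
  then show "\<beta> = \<gamma>"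
    using ordinal_linear[OF ordinal_\<alpha>] unfolding least_available_def by blast
qed

lemma greedy_mem:
  assumes "greedy t" and "rel t x \<beta>"
  shows "\<beta> \<epsilon> app E g x"
  using assms rel_iff_app[OF fun_g] unfolding greedy_def least_available_def available_def by metis

lemma greedy_separates:
  assumes "greedy t" and "rel t x \<beta>" and "rel t y \<beta>"
  shows "app E f x = app E f y"
proof -
  have "x \<epsilon> X" "y \<epsilon> X" "\<not> lower y x" "\<not> lower x y"
    using assms unfolding greedy_def least_available_def available_def by blast+
  then show ?thesis
    using ordinal_linear[OF ordinal_\<kappa>] range_f unfolding lower_iff by blast
qed

lemma greedy_exhausts:
  assumes "greedy t" and x: "x \<epsilon> X" "\<not> (\<exists>\<gamma>. rel t x \<gamma>)" and "\<beta> \<epsilon> \<alpha>" and "\<beta> \<epsilon> app E g x"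
  shows "\<exists>y. rel t y \<beta>"
proof (rule ccontr)
  assume "\<not> (\<exists>y. rel t y \<beta>)"
  then have "available t x \<beta>"
    using x(1) \<open>\<beta> \<epsilon> app E g x\<close> rel_iff_app[OF fun_g] unfolding available_def by blast
  moreover have "definable E (\<lambda>e. available t x (e 0))"
    by (intro definable_intros definable_available)
  ultimately obtain \<gamma> where "\<gamma> \<epsilon> \<alpha>" "least_available t x \<gamma>"
    using ordinal_least[OF ordinal_\<alpha> _ \<open>\<beta> \<epsilon> \<alpha>\<close>] unfolding least_available_def by metis
  then show False
    using \<open>greedy t\<close> x unfolding greedy_def by blast
qed

end

locale ultrapower_greedy_choice = ZF_ultrafilter E X U + greedy_choice E X \<kappa> \<alpha> f g
  for E :: "'v \<Rightarrow> 'v \<Rightarrow> bool" (infix \<open>\<epsilon>\<close> 50) and X U \<kappa> \<alpha> f g :: 'v +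
  assumes f_nonconstant: "\<not> (\<forall>\<^sub>F x in large. app E f x = c)"
    and eventually_mem_g: "\<beta> \<epsilon> \<alpha> \<Longrightarrow> \<forall>\<^sub>F x in large. \<beta> \<epsilon> app E g x"
    and selector_constant: "\<lbrakk>fun_on E X h; \<forall>\<^sub>F x in large. app E h x \<epsilon> app E g x\<rbrakk> \<Longrightarrow>
      \<exists>\<beta>. \<forall>\<^sub>F x in large. app E h x = \<beta>"
begin

lemma greedy_not_eventually_defined:
  assumes t: "greedy t"
  shows "\<not> (\<forall>\<^sub>F x in large. \<exists>\<beta>. rel t x \<beta>)"
proof
  assume defined: "\<forall>\<^sub>F x in large. \<exists>\<beta>. rel t x \<beta>"
  have t_rel: "relation_between X \<alpha> t"
    using t unfolding greedy_def by blast
  obtain x \<gamma> where "rel t x \<gamma>"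
    using eventually_happens'[OF large_neq_bot defined] by blast
  then have "\<gamma> \<epsilon> \<alpha>"
    using relation_betweenD[OF t_rel] by blast
  then obtain h where h: "fun_on E X h" and h_extends: "\<And>x \<beta>. rel t x \<beta> \<Longrightarrow> app E h x = \<beta>"
    using ex_fun_on_extending[OF t_rel right_unique_greedy[OF t]] by meson
  have "\<forall>\<^sub>F x in large. app E h x \<epsilon> app E g x"
    using defined by (rule eventually_mono) (auto simp: h_extends intro: greedy_mem[OF t])
  then obtain \<beta> where "\<forall>\<^sub>F x in large. app E h x = \<beta>"
    using selector_constant[OF h] by blast
  with defined have t_const: "\<forall>\<^sub>F x in large. rel t x \<beta>"
    by eventually_elim (auto dest: h_extends)
  then obtain y where y: "rel t y \<beta>"
    using eventually_happens'[OF large_neq_bot] by blast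
  from t_const have "\<forall>\<^sub>F x in large. app E f x = app E f y"
    by eventually_elim (rule greedy_separates[OF t _ y])
  then show False
    using f_nonconstant by blast
qed

lemma greedy_onto:
  assumes t: "greedy t" and "\<beta> \<epsilon> \<alpha>"
  shows "\<exists>x. rel t x \<beta>"
proof -
  have "definable E (\<lambda>e. \<exists>\<gamma>. rel t (e 0) \<gamma>)"
    by (intro definable_intros)
  from eventually_large_cases[OF this]
  have "\<forall>\<^sub>F x in large. \<not> (\<exists>\<gamma>. rel t x \<gamma>)"
    using greedy_not_eventually_defined[OF t] by blast
  with eventually_in_space eventually_mem_g[OF \<open>\<beta> \<epsilon> \<alpha>\<close>]
  have "\<forall>\<^sub>F x in large. \<exists>y. rel t y \<beta>"
    by eventually_elim (use greedy_exhausts[OF t] \<open>\<beta> \<epsilon> \<alpha>\<close> in blast)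
  then show ?thesis
    using eventually_happens'[OF large_neq_bot] by blast
qed

lemma surj_le_space: "surj_le E \<alpha> X"
proof -
  obtain t where t: "greedy t"
    using ex_greedy by blast
  then show ?thesis
    using surj_leI right_unique_greedy greedy_onto unfolding greedy_def by blast
qed

end

theorem mainTheorem12:
  fixes E :: "'v \<Rightarrow> 'v \<Rightarrow> bool" and X U \<kappa> \<alpha> :: 'v
  assumes "ZF_model E"
    and "surj_le E (cprod E X X) X"
    and "ultrafilter_over E X U"
    and "critical_point E X U \<kappa>"
    and "ordinal E \<alpha>"
    and "ord_le E \<kappa> \<alpha>"
    and "image_in_ultrapower E X U \<alpha>"
  shows "surj_le E \<alpha> X"
proof -
  interpret ZF_ultrafilter E X U
    using assms(1,3) by (intro ZF_ultrafilter.intro ZF_ultrafilter_axioms.intro)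
  have "ordinal E \<kappa>" "has_nonconstant_fun E X U \<kappa>"
    using assms(4) unfolding critical_point_def by blast+
  obtain f where f: "fun_on E X f" "\<And>x. E x X \<Longrightarrow> E (app E f x) \<kappa>"
    "\<And>c. \<not> (\<forall>\<^sub>F x in large. app E f x = c)"
    using has_nonconstant_funE[OF \<open>has_nonconstant_fun E X U \<kappa>\<close>] by blast
  obtain g where g: "fun_on E X g"
    "\<And>\<beta>. E \<beta> \<alpha> \<Longrightarrow> \<forall>\<^sub>F x in large. E \<beta> (app E g x)"
    "\<And>h. \<lbrakk>fun_on E X h; \<forall>\<^sub>F x in large. E (app E h x) (app E g x)\<rbrakk> \<Longrightarrow>
      \<exists>\<beta>. \<forall>\<^sub>F x in large. app E h x = \<beta>"
    using image_in_ultrapowerE[OF assms(7)] by blast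
  interpret ultrapower_greedy_choice E X U \<kappa> \<alpha> f g
    by unfold_locales (use \<open>ordinal E \<kappa>\<close> assms(5) f g in blast)+
  show ?thesis
    by (rule surj_le_space)
qed

end
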